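(* Let $\eta>0$, and let $M$, $K$, $m$ be the mass matrix, stiffness matrix and mean-value vector of the piecewise linear finite element space described in the context, with $\bar K=K+mm^T$. Let $$\mathcal{A}=\begin{pmatrix}\bar K & M\\ M & -\eta\bar K\end{pmatrix},\qquad \mathcal{B}_{\mathrm{bdsc}}=\begin{pmatrix}\bar K & 0\\ 0 & S_{\mathrm{pre}}\end{pmatrix},\qquad S_{\mathrm{pre}}=\eta(\bar K+\eta^{-1/2}M)\,\bar K^{-1}\,(\bar K+\eta^{-1/2}M).$$ Then every eigenvalue satisfies $$\lambda(\mathcal{B}_{\mathrm{bdsc}}^{-1}\mathcal{A})\in\left[-1,\,1-\sqrt2\right]\cup\left[1,\,\tfrac{\sqrt5+1}{2}\right].$$
   Context: Let $\Omega=(0,1)\times(0,1)$, let $\mathcal{T}_h$ be a triangulation of $\Omega$ with node set $\mathcal{N}_h$, $n=|\mathcal{N}_h|$, and let $(\lambda_p)_{p\in\mathcal{N}_h}$ be the nodal basis of the space of continuous functions on $\bar\Omega$ that are linear on each triangle (no boundary conditions imposed). The mass matrix is $M=(\int_\Omega \lambda_p\lambda_q\,dx)_{p,q}$, the stiffness matrix is $K=(\int_\Omega \nabla\lambda_p\cdot\nabla\lambda_q\,dx)_{p,q}$, and $m=(\int_\Omega\lambda_p\,dx)_p\in\mathbb{R}^n$. The parameter is $\eta=\epsilon\tau>0$, with $\epsilon>0$ the interface parameter and $\tau>0$ the time step. *)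

theory Defs
  imports
    "HOL-Analysis.Analysis"
    "Jordan_Normal_Form.Char_Poly"
    "Jordan_Normal_Form.Gauss_Jordan_Elimination"
begin

subsection \<open>Piecewise linear finite elements on the unit square\<close>

definition Omega :: "(real \<times> real) set"
  where "Omega = {0<..<1} \<times> {0<..<1}"

text \<open>The library's \<^const>\<open>triangulation\<close> says that the family is finite, consists of simplices and is
  conforming (two members meet in a common face); it does not fix the dimension of the simplices.
  Only the triangles themselves are members of a mesh, not their edges and vertices.\<close>

definition mesh :: "(real \<times> real) set set \<Rightarrow> bool"
  where "mesh \<T> \<longleftrightarrow>
    triangulation \<T> \<and> (\<forall>T\<in>\<T>. 2 simplex T) \<and> \<Union>\<T> = closure Omega"

definition mesh_nodes :: "(real \<times> real) set set \<Rightarrow> (real \<times> real) set"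
  where "mesh_nodes \<T> = {p. \<exists>T\<in>\<T>. p extreme_point_of T}"

text \<open>A function on the closed square is represented by a total function whose values outside
  the square are arbitrary; nothing below depends on them. No boundary condition is imposed.\<close>

definition fe_space :: "(real \<times> real) set set \<Rightarrow> (real \<times> real \<Rightarrow> real) set"
  where "fe_space \<T> = {v. continuous_on (closure Omega) v \<and>
    (\<forall>T\<in>\<T>. \<exists>g c. \<forall>x\<in>T. v x = inner g x + c)}"

definition nodal_basis ::
    "(real \<times> real) set set \<Rightarrow> (real \<times> real \<Rightarrow> real \<times> real \<Rightarrow> real) \<Rightarrow> bool"
  where "nodal_basis \<T> \<phi> \<longleftrightarrow>
    (\<forall>p\<in>mesh_nodes \<T>. \<phi> p \<in> fe_space \<T> \<and>
       (\<forall>q\<in>mesh_nodes \<T>. \<phi> p q = (if q = p then 1 else 0)))"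

text \<open>The gradient of a piecewise linear function exists off the edges of the mesh, that is,
  almost everywhere; its unspecified value elsewhere does not affect the integrals below. It agrees
  almost everywhere with the weak gradient.\<close>

definition grad :: "(real \<times> real \<Rightarrow> real) \<Rightarrow> real \<times> real \<Rightarrow> real \<times> real"
  where "grad f x = (THE D. GDERIV f x :> D)"

text \<open>In the following, the \<open>n\<close> nodes are numbered as \<open>node 0, \<dots>, node (n - 1)\<close>.\<close>

definition mass_matrix ::
    "nat \<Rightarrow> (nat \<Rightarrow> real \<times> real) \<Rightarrow> (real \<times> real \<Rightarrow> real \<times> real \<Rightarrow> real) \<Rightarrow> real mat"
  where "mass_matrix n node \<phi> = mat n n
    (\<lambda>(i, j). LINT x:Omega|lebesgue. \<phi> (node i) x * \<phi> (node j) x)"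

definition stiffness_matrix ::
    "nat \<Rightarrow> (nat \<Rightarrow> real \<times> real) \<Rightarrow> (real \<times> real \<Rightarrow> real \<times> real \<Rightarrow> real) \<Rightarrow> real mat"
  where "stiffness_matrix n node \<phi> = mat n n
    (\<lambda>(i, j). LINT x:Omega|lebesgue. inner (grad (\<phi> (node i)) x) (grad (\<phi> (node j)) x))"

definition mean_vector ::
    "nat \<Rightarrow> (nat \<Rightarrow> real \<times> real) \<Rightarrow> (real \<times> real \<Rightarrow> real \<times> real \<Rightarrow> real) \<Rightarrow> real vec"
  where "mean_vector n node \<phi> = vec n (\<lambda>i. LINT x:Omega|lebesgue. \<phi> (node i) x)"

subsection \<open>The block matrices\<close>

definition Kbar_matrix :: "real mat \<Rightarrow> real vec \<Rightarrow> real mat"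
  where "Kbar_matrix K m =
    K + mat_of_cols (dim_vec m) [m] * mat_of_rows (dim_vec m) [m]"

text \<open>\<^const>\<open>mat_inverse\<close> is an option, so \<open>minv X\<close> is specified exactly when \<open>X\<close> is invertible.\<close>

definition minv :: "real mat \<Rightarrow> real mat"
  where "minv X = the (mat_inverse X)"

definition system_matrix :: "real \<Rightarrow> real mat \<Rightarrow> real mat \<Rightarrow> real mat"
  where "system_matrix \<eta> Kb M = four_block_mat Kb M M (- (\<eta> \<cdot>\<^sub>m Kb))"

definition S_pre :: "real \<Rightarrow> real mat \<Rightarrow> real mat \<Rightarrow> real mat"
  where "S_pre \<eta> Kb M =
    \<eta> \<cdot>\<^sub>m ((Kb + (\<eta> powr (-1/2)) \<cdot>\<^sub>m M) * minv Kb * (Kb + (\<eta> powr (-1/2)) \<cdot>\<^sub>m M))"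

definition B_bdsc :: "real \<Rightarrow> real mat \<Rightarrow> real mat \<Rightarrow> real mat"
  where "B_bdsc \<eta> Kb M =
    four_block_mat Kb (0\<^sub>m (dim_row Kb) (dim_col Kb)) (0\<^sub>m (dim_row Kb) (dim_col Kb)) (S_pre \<eta> Kb M)"

end

theory Submission
  imports Defs
begin

text \<open>The bounds hold for any symmetric matrices \<open>Kb\<close> and \<open>M\<close>, the first positive definite, the second
  positive semidefinite. If \<open>Kb\<close> and \<open>M\<close> are diagonalised simultaneously and \<open>s \<ge> 0\<close> stands for an eigenvalue
  of \<open>\<eta>\<^sup>-\<^sup>1\<^sup>/\<^sup>2 Kb\<^sup>-\<^sup>1 M\<close>, then after rescaling the second unknown, the eigenvalues are those of the pencil
  with system matrix \<open>((1, s), (s, -1))\<close> and preconditioner \<open>diag (1, (1 + s)\<^sup>2)\<close>, that is, the roots of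
  \<open>(1 + s)\<^sup>2 (z\<^sup>2 - z) + z - 1 - s\<^sup>2\<close>. This quadratic is nonnegative at \<open>-1\<close> and at the golden ratio; it is \<open>- s\<^sup>2\<close> at
  \<open>1\<close> and \<open>(1 - \<surd>2) (s - \<surd>2)\<^sup>2\<close> at \<open>1 - \<surd>2\<close>, so each interval contains one of its two roots.

  The diagonalisation can be bypassed. Eliminating the first block of an eigenvector and pairing the second block row
  with the second block \<open>y\<close> gives the same quadratic in an averaged form, with \<open>1, s, s\<^sup>2\<close> replaced by three
  real numbers \<open>\<alpha>, b, c\<close>; the inequality \<open>(s - \<surd>2)\<^sup>2 \<ge> 0\<close> becomes the nonnegativity of the squared
  \<open>Kb\<close>-norm of one vector. This is \<open>bdsc_eigenvalue_bounds\<close>, with the root location in \<open>bdsc_quadratic_roots\<close>.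

  For the finite element matrices, the quadratic form of \<open>M\<close> at the coefficients of \<open>u\<close> is \<open>\<integral>u\<^sup>2\<close>, and that of \<open>Kb\<close>
  is \<open>\<integral>\<bar>\<nabla>u\<bar>\<^sup>2 + (\<integral>u)\<^sup>2\<close>. The latter vanishes only for a constant of mean zero
  (\<open>Kbar_matrix_positive_definite\<close>). In particular \<open>Kb\<close> and the preconditioner are invertible, so that their
  inverses have their usual meaning.\<close>

unbundle no inner_syntax and no vec_syntax

section \<open>Roots of the scalar quadratic\<close>

text \<open>A real quadratic with positive leading and negative constant coefficient has one negative and one
  positive root, so a sign change on either side of the origin captures both. The root \<open>r\<close> and the
  value at \<open>t\<close> are linked by \<open>r q(t) = (t - r) (a r t - c)\<close>, where the second factor is positive
  whenever \<open>t\<close> and \<open>r\<close> have the same sign.\<close>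

lemma quadratic_roots_between_sign_changes:
  fixes a b c :: real and z :: complex
  assumes a: "a > 0" and c: "c < 0"
    and l: "a * l\<^sup>2 + b * l + c \<ge> 0" "l < 0"
    and m: "a * m\<^sup>2 + b * m + c \<le> 0" "m < 0"
    and p: "a * p\<^sup>2 + b * p + c \<le> 0" "p > 0"
    and q: "a * q\<^sup>2 + b * q + c \<ge> 0" "q > 0"
    and z: "complex_of_real a * z\<^sup>2 + complex_of_real b * z + complex_of_real c = 0"
  shows "z \<in> complex_of_real ` ({l..m} \<union> {p..q})"
proof -
  have im: "Im z * (2 * a * Re z + b) = 0" and re: "a * ((Re z)\<^sup>2 - (Im z)\<^sup>2) + b * Re z + c = 0"
    using arg_cong[OF z, of Im] arg_cong[OF z, of Re] by (simp_all add: power2_eq_square algebra_simps)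
  have "Im z = 0"
  proof (rule ccontr)
    assume "Im z \<noteq> 0"
    with im have "b = - 2 * a * Re z" by auto
    with re have "c = a * ((Re z)\<^sup>2 + (Im z)\<^sup>2)" by (simp add: power2_eq_square algebra_simps)
    moreover have "\<dots> \<ge> 0" using a by simp
    ultimately show False using c by simp
  qed
  define r where "r = Re z"
  have zr: "z = complex_of_real r" using \<open>Im z = 0\<close> by (simp add: r_def complex_eq_iff)
  have root: "a * r\<^sup>2 + b * r + c = 0" using re \<open>Im z = 0\<close> by (simp add: r_def)
  have r0: "r \<noteq> 0" using root c by auto
  have key: "r * (a * t\<^sup>2 + b * t + c) = (t - r) * (a * r * t - c)" for t
  proof -
    have b: "b * r = - (a * r\<^sup>2) - c" using root by simp
    have "r * (a * t\<^sup>2 + b * t + c) = a * r * t\<^sup>2 + (b * r) * t + c * r" by (simp add: algebra_simps)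
    also have "\<dots> = (t - r) * (a * r * t - c)" unfolding b by (simp add: power2_eq_square algebra_simps)
    finally show ?thesis .
  qed
  have pos: "a * r * t - c > 0" if "r * t > 0" for t
    using mult_pos_pos[OF a that] c by (simp add: mult.assoc)
  show ?thesis
  proof (cases "r > 0")
    case True
    have "p \<le> r"
      using key[of p] pos[of p] mult_nonneg_nonpos[of r] True p
      by (smt (verit) mult_pos_pos)
    moreover have "r \<le> q"
      using key[of q] pos[of q] mult_nonneg_nonneg[of r] True q
      by (smt (verit) mult_pos_pos mult_neg_pos)
    ultimately show ?thesis using zr by auto
  next
    case False
    then have n: "r < 0" using r0 by simp
    have "l \<le> r"
      using key[of l] pos[of l] mult_nonpos_nonneg[of r] n l
      by (smt (verit) mult_pos_pos mult_neg_neg)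
    moreover have "r \<le> m"
      using key[of m] pos[of m] mult_nonpos_nonpos[of r] n m
      by (smt (verit) mult_neg_pos mult_neg_neg)
    ultimately show ?thesis using zr by auto
  qed
qed

text \<open>The four endpoints of the spectral bounds. In the scalar case \<open>\<alpha> = 1\<close>, \<open>b = s\<close>, \<open>c = s\<^sup>2\<close> with \<open>s \<ge> 0\<close>, the
  value at \<open>1 - \<surd>2\<close> is \<open>(1 - \<surd>2) (s - \<surd>2)\<^sup>2\<close>; the hypothesis \<open>cs\<close> is what replaces this square
  in general. The endpoints \<open>-1\<close> and \<open>1\<close> are the roots for \<open>s = 0\<close>, the golden ratio is the limit of the
  positive root for \<open>s \<rightarrow> \<infinity>\<close>, and \<open>1 - \<surd>2\<close> is attained for \<open>s = \<surd>2\<close>.\<close>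

lemma bdsc_quadratic_roots:
  fixes \<alpha> b c :: real and z :: complex
  assumes \<alpha>: "\<alpha> > 0" and b: "b \<ge> 0" and c: "c \<ge> 0"
    and cs: "2 * \<alpha> - 2 * sqrt 2 * b + c \<ge> 0"
    and z: "complex_of_real (\<alpha> + 2 * b + c) * z\<^sup>2 + complex_of_real (- (2 * b + c)) * z
        + complex_of_real (- (\<alpha> + c)) = 0"
  shows "z \<in> complex_of_real ` ({-1 .. 1 - sqrt 2} \<union> {1 .. (sqrt 5 + 1) / 2})"
proof (rule quadratic_roots_between_sign_changes[OF _ _ _ _ _ _ _ _ _ _ z])
  show "\<alpha> + 2 * b + c > 0" "- (\<alpha> + c) < 0" using \<alpha> b c by simp_all
  show "(\<alpha> + 2 * b + c) * (- 1)\<^sup>2 + - (2 * b + c) * - 1 + - (\<alpha> + c) \<ge> 0" using b c by simp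
  have "(\<alpha> + 2 * b + c) * (1 - sqrt 2)\<^sup>2 + - (2 * b + c) * (1 - sqrt 2) + - (\<alpha> + c)
      = (1 - sqrt 2) * (2 * \<alpha> - 2 * sqrt 2 * b + c)"
    by (simp add: power2_eq_square algebra_simps)
  also have "\<dots> \<le> 0" using cs by (intro mult_nonpos_nonneg) auto
  finally show "(\<alpha> + 2 * b + c) * (1 - sqrt 2)\<^sup>2 + - (2 * b + c) * (1 - sqrt 2) + - (\<alpha> + c) \<le> 0" .
  show "(\<alpha> + 2 * b + c) * 1\<^sup>2 + - (2 * b + c) * 1 + - (\<alpha> + c) \<le> 0" using c by simp
  have "(\<alpha> + 2 * b + c) * ((sqrt 5 + 1) / 2)\<^sup>2 + - (2 * b + c) * ((sqrt 5 + 1) / 2) + - (\<alpha> + c)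
      = 2 * b + \<alpha> * ((sqrt 5 + 1) / 2)"
    by (simp add: power2_eq_square field_simps)
  also have "\<dots> \<ge> 0" using b \<alpha> by simp
  finally show "(\<alpha> + 2 * b + c) * ((sqrt 5 + 1) / 2)\<^sup>2 + - (2 * b + c) * ((sqrt 5 + 1) / 2) + - (\<alpha> + c) \<ge> 0" .
qed (auto intro: add_pos_pos)

section \<open>Real symmetric matrices acting on complex vectors\<close>

lemma minv_inverse:
  assumes A: "A \<in> carrier_mat n n" and det: "det A \<noteq> 0"
  shows "minv A \<in> carrier_mat n n" "A * minv A = 1\<^sub>m n" "minv A * A = 1\<^sub>m n"
proof -
  have "mat_inverse A \<noteq> None"
    using mat_inverse(1)[OF A, where b = "()"] det_non_zero_imp_unit[OF A det, of "()"] by blast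
  then show "minv A \<in> carrier_mat n n" "A * minv A = 1\<^sub>m n" "minv A * A = 1\<^sub>m n"
    using mat_inverse(2)[OF A] by (auto simp: minv_def)
qed

lemma det_nonzero_if_positive_definite:
  fixes P :: "real mat"
  assumes P: "P \<in> carrier_mat n n"
    and pd: "\<And>v. v \<in> carrier_vec n \<Longrightarrow> v \<noteq> 0\<^sub>v n \<Longrightarrow> v \<bullet> (P *\<^sub>v v) > 0"
  shows "det P \<noteq> 0"
proof
  assume "det P = 0"
  then obtain v where "v \<in> carrier_vec n" "v \<noteq> 0\<^sub>v n" "P *\<^sub>v v = 0\<^sub>v n"
    using det_0_iff_vec_prod_zero[OF P] by auto
  then show False using pd[of v] by simp
qed

abbreviation cmat :: "real mat \<Rightarrow> complex mat" where "cmat \<equiv> map_mat complex_of_real"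

text \<open>The preconditioned matrix is not symmetric, so its eigenvectors are a priori complex, while definiteness
  is a condition on real vectors. The form mediates between the two.\<close>

definition sesq_form :: "real mat \<Rightarrow> complex vec \<Rightarrow> complex vec \<Rightarrow> complex"
  where "sesq_form P v w = (cmat P *\<^sub>v v) \<bullet> conjugate w"

lemma sesq_sum:
  assumes "P \<in> carrier_mat n n" "v \<in> carrier_vec n" "w \<in> carrier_vec n"
  shows "sesq_form P v w = (\<Sum>i<n. \<Sum>j<n. P $$ (i,j) * v $ j * cnj (w $ i))"
  using assms
  by (simp add: sesq_form_def scalar_prod_def sum_distrib_right lessThan_atLeast0)

lemma sesq_hermitian:
  assumes P: "P \<in> carrier_mat n n" and sym: "transpose_mat P = P" and v: "v \<in> carrier_vec n" and w: "w \<in> carrier_vec n"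
  shows "sesq_form P w v = cnj (sesq_form P v w)"
proof -
  have s: "P $$ (i,j) = P $$ (j,i)" if "i < n" "j < n" for i j
    using arg_cong[OF sym, of "\<lambda>A. A $$ (i,j)"] that P by simp
  show ?thesis
    unfolding sesq_sum[OF P v w] sesq_sum[OF P w v] cnj_sum
    by (subst sum.swap) (auto intro!: sum.cong simp: s)
qed

lemma smult_mat_mult_vec:
  fixes c :: "'a :: comm_semiring_1"
  assumes "A \<in> carrier_mat nr nc" "v \<in> carrier_vec nc"
  shows "(c \<cdot>\<^sub>m A) *\<^sub>v v = c \<cdot>\<^sub>v (A *\<^sub>v v)"
  using assms by (intro eq_vecI) (auto simp: scalar_prod_def sum_distrib_left mult.assoc)

lemma sesq_add:
  assumes "P \<in> carrier_mat n n" "u \<in> carrier_vec n" "v \<in> carrier_vec n" "w \<in> carrier_vec n"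
  shows "sesq_form P (u + v) w = sesq_form P u w + sesq_form P v w"
  using assms by (simp add: sesq_sum[of _ n] algebra_simps sum.distrib)

lemma sesq_smult:
  assumes "P \<in> carrier_mat n n" "u \<in> carrier_vec n" "w \<in> carrier_vec n"
  shows "sesq_form P (c \<cdot>\<^sub>v u) w = c * sesq_form P u w"
  using assms by (simp add: sesq_sum[of _ n] sum_distrib_left algebra_simps)

lemma sesq_smult_right:
  assumes "P \<in> carrier_mat n n" "u \<in> carrier_vec n" "w \<in> carrier_vec n"
  shows "sesq_form P u (c \<cdot>\<^sub>v w) = cnj c * sesq_form P u w"
  using assms by (simp add: sesq_sum[of _ n] sum_distrib_left algebra_simps)

lemma sesq_add_right:
  assumes "P \<in> carrier_mat n n" "u \<in> carrier_vec n" "v \<in> carrier_vec n" "w \<in> carrier_vec n"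
  shows "sesq_form P u (v + w) = sesq_form P u v + sesq_form P u w"
  using assms by (simp add: sesq_sum[of _ n] algebra_simps sum.distrib)

lemma sesq_add_mat:
  assumes "P \<in> carrier_mat n n" "Q \<in> carrier_mat n n" "u \<in> carrier_vec n" "w \<in> carrier_vec n"
  shows "sesq_form (P + Q) u w = sesq_form P u w + sesq_form Q u w"
  using assms by (simp add: sesq_sum[of _ n] algebra_simps sum.distrib)

lemma sesq_smult_mat:
  assumes "P \<in> carrier_mat n n" "u \<in> carrier_vec n" "w \<in> carrier_vec n"
  shows "sesq_form (c \<cdot>\<^sub>m P) u w = of_real c * sesq_form P u w"
  using assms by (simp add: sesq_sum[of _ n] sum_distrib_left algebra_simps)

text \<open>The cross terms between the real and the imaginary part of the vector cancel by symmetry; this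
  carries definiteness over from real to complex vectors.\<close>

lemma sesq_diagonal:
  assumes P: "P \<in> carrier_mat n n" and sym: "transpose_mat P = P" and v: "v \<in> carrier_vec n"
  shows "sesq_form P v v = complex_of_real
    (map_vec Re v \<bullet> (P *\<^sub>v map_vec Re v) + map_vec Im v \<bullet> (P *\<^sub>v map_vec Im v))"
proof (rule complex_eqI)
  show "Im (sesq_form P v v) = Im (complex_of_real
    (map_vec Re v \<bullet> (P *\<^sub>v map_vec Re v) + map_vec Im v \<bullet> (P *\<^sub>v map_vec Im v)))"
    using arg_cong[OF sesq_hermitian[OF P sym v v], of Im] by simp
  show "Re (sesq_form P v v) = Re (complex_of_real
    (map_vec Re v \<bullet> (P *\<^sub>v map_vec Re v) + map_vec Im v \<bullet> (P *\<^sub>v map_vec Im v)))"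
    unfolding sesq_sum[OF P v v] using P v
    by (simp add: scalar_prod_def sum_distrib_left lessThan_atLeast0
       flip: sum.distrib) (auto intro!: sum.cong simp: algebra_simps)
qed

lemma sesq_diagonal_nonneg:
  assumes P: "P \<in> carrier_mat n n" and sym: "transpose_mat P = P" and v: "v \<in> carrier_vec n"
    and psd: "\<And>v. v \<in> carrier_vec n \<Longrightarrow> v \<bullet> (P *\<^sub>v v) \<ge> 0"
  obtains r where "sesq_form P v v = complex_of_real r" "r \<ge> 0"
  using sesq_diagonal[OF P sym v] psd[of "map_vec Re v"] psd[of "map_vec Im v"] v
  by (metis add_nonneg_nonneg map_carrier_vec)

lemma sesq_diagonal_pos:
  assumes P: "P \<in> carrier_mat n n" and sym: "transpose_mat P = P" and v: "v \<in> carrier_vec n" "v \<noteq> 0\<^sub>v n"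
    and pd: "\<And>v. v \<in> carrier_vec n \<Longrightarrow> v \<noteq> 0\<^sub>v n \<Longrightarrow> v \<bullet> (P *\<^sub>v v) > 0"
  obtains r where "sesq_form P v v = complex_of_real r" "r > 0"
proof -
  have psd: "u \<bullet> (P *\<^sub>v u) \<ge> 0" if "u \<in> carrier_vec n" for u
    using pd[OF that] P that by (cases "u = 0\<^sub>v n") (auto simp: less_imp_le)
  have "map_vec Re v \<noteq> 0\<^sub>v n \<or> map_vec Im v \<noteq> 0\<^sub>v n"
  proof (rule ccontr)
    assume "\<not> ?thesis"
    then have eq: "map_vec Re v = 0\<^sub>v n" "map_vec Im v = 0\<^sub>v n" by auto
    have "v $ i = 0" if "i < n" for i
      using arg_cong[OF eq(1), of "\<lambda>u. u $ i"] arg_cong[OF eq(2), of "\<lambda>u. u $ i"] that v(1)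
      by (simp add: complex_eq_iff)
    then have "v = 0\<^sub>v n" using v(1) by (intro eq_vecI) auto
    then show False using v(2) by simp
  qed
  then have "map_vec Re v \<bullet> (P *\<^sub>v map_vec Re v) + map_vec Im v \<bullet> (P *\<^sub>v map_vec Im v) > 0"
    using psd[of "map_vec Re v"] psd[of "map_vec Im v"] pd[of "map_vec Re v"] pd[of "map_vec Im v"] v(1)
    by (auto intro: add_pos_nonneg add_nonneg_pos)
  then show thesis using that sesq_diagonal[OF P sym v(1)] by blast
qed

section \<open>Eigenvalues of the preconditioned block system\<close>

text \<open>For an eigenpair \<open>z\<close>, \<open>(x, y)\<close> of the pencil put \<open>w = (z - 1) x\<close>. The first block row says
  \<open>Kb w = M y\<close>. With \<open>s = \<eta>\<^sup>-\<^sup>1\<^sup>/\<^sup>2\<close> this gives \<open>S_pre y = \<eta> (Kb + s M) (y + s w)\<close>, so that \<open>Kb\<^sup>-\<^sup>1\<close>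
  disappears. Multiplying the second block row by \<open>z - 1\<close> and pairing it with \<open>y\<close> leaves
  \<open>c - (z - 1) \<alpha> = z (z - 1) (\<alpha> + 2 b + c)\<close> with the real numbers \<open>\<alpha> = y\<^sup>* Kb y\<close>,
  \<open>b = s y\<^sup>* M y\<close> and \<open>c = s\<^sup>2 w\<^sup>* Kb w\<close>. The square that decides the bound \<open>1 - \<surd>2\<close> is the squared
  \<open>Kb\<close>-norm of \<open>s w - \<surd>2 y\<close>.\<close>

lemma bdsc_eigenvalue_bounds:
  fixes Kb M :: "real mat" and \<eta> :: real and z :: complex
  assumes K: "Kb \<in> carrier_mat n n" "transpose_mat Kb = Kb"
    and Kpd: "\<And>v. v \<in> carrier_vec n \<Longrightarrow> v \<noteq> 0\<^sub>v n \<Longrightarrow> v \<bullet> (Kb *\<^sub>v v) > 0"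
    and M: "M \<in> carrier_mat n n" "transpose_mat M = M"
    and Mpsd: "\<And>v. v \<in> carrier_vec n \<Longrightarrow> v \<bullet> (M *\<^sub>v v) \<ge> 0"
    and \<eta>: "\<eta> > 0"
    and ev: "eigenvalue (map_mat complex_of_real (minv (B_bdsc \<eta> Kb M) * system_matrix \<eta> Kb M)) z"
  shows "z \<in> complex_of_real ` ({-1 .. 1 - sqrt 2} \<union> {1 .. (sqrt 5 + 1) / 2})"
proof -
  define s where "s = \<eta> powr (-1/2)"
  have s: "s > 0" "\<eta> * s\<^sup>2 = 1" using \<eta> by (simp_all add: s_def power2_eq_square powr_minus_divide flip: powr_add)
  define N where "N = Kb + s \<cdot>\<^sub>m M"
  have N: "N \<in> carrier_mat n n" using K M by (simp add: N_def)
  have "det Kb \<noteq> 0" using det_nonzero_if_positive_definite[OF K(1) Kpd] .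
  note Ki = minv_inverse[OF K(1) this]
  have "v \<bullet> (N *\<^sub>v v) > 0" if "v \<in> carrier_vec n" "v \<noteq> 0\<^sub>v n" for v
  proof -
    have "N *\<^sub>v v = Kb *\<^sub>v v + s \<cdot>\<^sub>v (M *\<^sub>v v)"
      unfolding N_def using K M that by (simp add: add_mult_distrib_mat_vec[of _ n n] smult_mat_mult_vec)
    then show ?thesis using K M that Kpd[OF that] Mpsd[OF that(1)] s(1)
      by (simp add: scalar_prod_add_distrib[of _ n] add_pos_nonneg)
  qed
  then have detN: "det N \<noteq> 0" using det_nonzero_if_positive_definite[OF N] by blast
  have Sdef: "S_pre \<eta> Kb M = \<eta> \<cdot>\<^sub>m (N * minv Kb * N)" by (simp add: S_pre_def N_def s_def)
  have S: "S_pre \<eta> Kb M \<in> carrier_mat n n" unfolding Sdef using N Ki by simp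
  have "det (minv Kb) \<noteq> 0"
    using arg_cong[OF Ki(2), of det] det_mult[OF K(1) Ki(1)] by auto
  then have "det (S_pre \<eta> Kb M) \<noteq> 0"
    unfolding Sdef using N Ki \<eta> detN by (simp add: det_mult[of _ n])
  then have detB: "det (B_bdsc \<eta> Kb M) \<noteq> 0"
    unfolding B_bdsc_def using K S \<open>det Kb \<noteq> 0\<close>
    by (simp add: det_four_block_mat_upper_right_zero[OF K(1) _ _ S])
  have B: "B_bdsc \<eta> Kb M \<in> carrier_mat (n + n) (n + n)"
    using K S by (auto simp: B_bdsc_def)
  note Bi = minv_inverse[OF B detB]
  have A: "system_matrix \<eta> Kb M \<in> carrier_mat (n + n) (n + n)"
    using K M by (auto simp: system_matrix_def)
  obtain v where v: "v \<in> carrier_vec (n + n)" "v \<noteq> 0\<^sub>v (n + n)"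
    and ev': "cmat (minv (B_bdsc \<eta> Kb M) * system_matrix \<eta> Kb M) *\<^sub>v v = z \<cdot>\<^sub>v v"
    using ev A Bi(1) by (auto simp: eigenvalue_def eigenvector_def)
  \<comment> \<open>The eigenvalue problem as a pencil: the preconditioner is moved to the right hand side.\<close>
  have gen: "cmat (system_matrix \<eta> Kb M) *\<^sub>v v = z \<cdot>\<^sub>v (cmat (B_bdsc \<eta> Kb M) *\<^sub>v v)"
  proof -
    have "cmat (system_matrix \<eta> Kb M) *\<^sub>v v = cmat (B_bdsc \<eta> Kb M * (minv (B_bdsc \<eta> Kb M) * system_matrix \<eta> Kb M)) *\<^sub>v v"
      using A B Bi by (simp flip: assoc_mult_mat[of _ "n+n" "n+n" _ "n+n" _ "n+n"])
    also have "\<dots> = cmat (B_bdsc \<eta> Kb M) *\<^sub>v (z \<cdot>\<^sub>v v)"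
      using A B Bi(1) v ev'
      by (simp add: of_real_hom.mat_hom_mult[OF B mult_carrier_mat[OF Bi(1) A]] assoc_mult_mat_vec[of _ "n+n" "n+n" _ "n+n"])
    also have "\<dots> = z \<cdot>\<^sub>v (cmat (B_bdsc \<eta> Kb M) *\<^sub>v v)"
      using B v by (simp add: mult_mat_vec[of _ "n+n" "n+n"])
    finally show ?thesis .
  qed
  define x y where "x = vec_first v n" and "y = vec_last v n"
  have xy: "x \<in> carrier_vec n" "y \<in> carrier_vec n" and vxy: "v = x @\<^sub>v y"
    using v by (auto simp: x_def y_def)
  have cK: "cmat Kb \<in> carrier_mat n n" and cM: "cmat M \<in> carrier_mat n n"
    and cN: "cmat N \<in> carrier_mat n n"
    and cKi: "cmat (minv Kb) \<in> carrier_mat n n"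
    using K M N Ki by auto
  have z0: "cmat (0\<^sub>m n n) = 0\<^sub>m n n" by (intro eq_matI) auto
  have z0v: "0\<^sub>m n n *\<^sub>v u = 0\<^sub>v n" if "u \<in> carrier_vec n" for u :: "complex vec"
    using that by (intro eq_vecI) auto
  have "(cmat Kb *\<^sub>v x + cmat M *\<^sub>v y) @\<^sub>v (cmat M *\<^sub>v x + cmat (- (\<eta> \<cdot>\<^sub>m Kb)) *\<^sub>v y)
    = (z \<cdot>\<^sub>v (cmat Kb *\<^sub>v x)) @\<^sub>v (z \<cdot>\<^sub>v (cmat (S_pre \<eta> Kb M) *\<^sub>v y))"
  proof -
    have "cmat (system_matrix \<eta> Kb M) *\<^sub>v v
        = (cmat Kb *\<^sub>v x + cmat M *\<^sub>v y) @\<^sub>v (cmat M *\<^sub>v x + cmat (- (\<eta> \<cdot>\<^sub>m Kb)) *\<^sub>v y)"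
      unfolding system_matrix_def vxy using K M xy
      by (subst map_four_block_mat[of _ n n _ n _ n], simp_all, subst four_block_mat_mult_vec[of _ n n _ n _ n], simp_all)
    moreover have "cmat (B_bdsc \<eta> Kb M) *\<^sub>v v = (cmat Kb *\<^sub>v x) @\<^sub>v (cmat (S_pre \<eta> Kb M) *\<^sub>v y)"
      unfolding B_bdsc_def vxy using K S xy
      by (subst map_four_block_mat[of _ n n _ n _ n], simp_all, subst four_block_mat_mult_vec[of _ n n _ n _ n], simp_all add: z0 z0v)
    moreover have "z \<cdot>\<^sub>v ((cmat Kb *\<^sub>v x) @\<^sub>v (cmat (S_pre \<eta> Kb M) *\<^sub>v y)) =
       (z \<cdot>\<^sub>v (cmat Kb *\<^sub>v x)) @\<^sub>v (z \<cdot>\<^sub>v (cmat (S_pre \<eta> Kb M) *\<^sub>v y))"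
      by (intro eq_vecI) auto
    ultimately show ?thesis using gen by simp
  qed
  then have eq1: "cmat Kb *\<^sub>v x + cmat M *\<^sub>v y = z \<cdot>\<^sub>v (cmat Kb *\<^sub>v x)"
    and eq2: "cmat M *\<^sub>v x + cmat (- (\<eta> \<cdot>\<^sub>m Kb)) *\<^sub>v y = z \<cdot>\<^sub>v (cmat (S_pre \<eta> Kb M) *\<^sub>v y)"
    using append_vec_eq[of "cmat Kb *\<^sub>v x + cmat M *\<^sub>v y" n "z \<cdot>\<^sub>v (cmat Kb *\<^sub>v x)"] K M xy
    by (auto)
  define w where "w = (z - 1) \<cdot>\<^sub>v x"
  have w: "w \<in> carrier_vec n" using xy by (simp add: w_def)
  have Kw: "cmat Kb *\<^sub>v w = cmat M *\<^sub>v y"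
  proof -
    have "cmat M *\<^sub>v y = (cmat Kb *\<^sub>v x + cmat M *\<^sub>v y) - cmat Kb *\<^sub>v x"
      using cK cM xy by (intro eq_vecI) auto
    also have "\<dots> = (z - 1) \<cdot>\<^sub>v (cmat Kb *\<^sub>v x)"
      unfolding eq1 using cK xy by (intro eq_vecI) (auto simp: algebra_simps)
    also have "\<dots> = cmat Kb *\<^sub>v w"
      unfolding w_def using cK xy by (simp add: mult_mat_vec[of _ n n])
    finally show ?thesis by simp
  qed
  define t where "t = y + complex_of_real s \<cdot>\<^sub>v w"
  have t: "t \<in> carrier_vec n" using xy w by (simp add: t_def)
  have Sy: "cmat (S_pre \<eta> Kb M) *\<^sub>v y = complex_of_real \<eta> \<cdot>\<^sub>v (cmat N *\<^sub>v t)"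
  proof -
    have cNdef: "cmat N = cmat Kb + complex_of_real s \<cdot>\<^sub>m cmat M"
      using K M by (intro eq_matI) (auto simp: N_def)
    have "cmat N *\<^sub>v y = cmat Kb *\<^sub>v y + complex_of_real s \<cdot>\<^sub>v (cmat Kb *\<^sub>v w)"
      unfolding cNdef Kw using cK cM xy
      by (simp add: add_mult_distrib_mat_vec[of _ n n] smult_mat_mult_vec[of _ n n])
    also have "\<dots> = cmat Kb *\<^sub>v t"
      unfolding t_def using cK xy w by (simp add: mult_add_distrib_mat_vec[of _ n n] mult_mat_vec[of _ n n])
    finally have Ny: "cmat N *\<^sub>v y = cmat Kb *\<^sub>v t" .
    have Kt: "cmat (minv Kb) *\<^sub>v (cmat Kb *\<^sub>v t) = t"
    proof -
      have "cmat (minv Kb) *\<^sub>v (cmat Kb *\<^sub>v t) = (cmat (minv Kb) * cmat Kb) *\<^sub>v t"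
        by (rule assoc_mult_mat_vec[OF cKi cK t, symmetric])
      also have "\<dots> = cmat (minv Kb * Kb) *\<^sub>v t"
        by (simp only: of_real_hom.mat_hom_mult[OF Ki(1) K(1)])
      also have "\<dots> = t" unfolding Ki(3) using t by (simp add: of_real_hom.mat_hom_one)
      finally show ?thesis .
    qed
    have "cmat (S_pre \<eta> Kb M) = complex_of_real \<eta> \<cdot>\<^sub>m (cmat N * cmat (minv Kb) * cmat N)"
    proof -
      have "cmat (\<eta> \<cdot>\<^sub>m (N * minv Kb * N)) = complex_of_real \<eta> \<cdot>\<^sub>m cmat (N * minv Kb * N)"
        by (intro eq_matI) auto
      then show ?thesis
        unfolding Sdef
        by (simp only: of_real_hom.mat_hom_mult[OF mult_carrier_mat[OF N Ki(1)] N]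
            of_real_hom.mat_hom_mult[OF N Ki(1)])
    qed
    then have "cmat (S_pre \<eta> Kb M) *\<^sub>v y = complex_of_real \<eta> \<cdot>\<^sub>v (cmat N *\<^sub>v (cmat (minv Kb) *\<^sub>v (cmat N *\<^sub>v y)))"
      using cN cKi xy by (simp add: smult_mat_mult_vec[of _ n n] assoc_mult_mat_vec[of _ n n _ n])
    then show ?thesis by (simp add: Ny Kt)
  qed
  show ?thesis
  proof (cases "y = 0\<^sub>v n")
    \<comment> \<open>Here \<open>w = 0\<close> although \<open>x \<noteq> 0\<close>, which forces \<open>z = 1\<close>.\<close>
    case True
    have "cmat M *\<^sub>v 0\<^sub>v n = 0\<^sub>v n" using cM by (intro eq_vecI) auto
    then have "cmat Kb *\<^sub>v w = 0\<^sub>v n" using Kw True by simp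
    then have "sesq_form Kb w w = 0" using w by (simp add: sesq_form_def)
    have "w = 0\<^sub>v n"
    proof (rule ccontr)
      assume "w \<noteq> 0\<^sub>v n"
      then show False using sesq_diagonal_pos[OF K w _ Kpd] \<open>sesq_form Kb w w = 0\<close> by force
    qed
    moreover have "x \<noteq> 0\<^sub>v n"
    proof
      assume "x = 0\<^sub>v n"
      then have "v = 0\<^sub>v (n + n)" unfolding vxy True by (intro eq_vecI) auto
      then show False using v by simp
    qed
    ultimately have "z = 1"
    proof -
      obtain i where i: "i < n" "x $ i \<noteq> 0" using \<open>x \<noteq> 0\<^sub>v n\<close> xy by (metis eq_vecI carrier_vecD index_zero_vec)
      have "(z - 1) * x $ i = 0" using arg_cong[OF \<open>w = 0\<^sub>v n\<close>, of "\<lambda>u. u $ i"] i xy by (simp add: w_def)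
      then show ?thesis using i by simp
    qed
    moreover have "sqrt 5 \<ge> 1" by simp
    ultimately show ?thesis by (intro image_eqI[of _ _ 1]) auto
  next
    case False
    obtain \<alpha> where \<alpha>: "sesq_form Kb y y = complex_of_real \<alpha>" "\<alpha> > 0"
      using sesq_diagonal_pos[OF K xy(2) False Kpd] .
    obtain \<beta> where \<beta>: "sesq_form M y y = complex_of_real \<beta>" "\<beta> \<ge> 0"
      using sesq_diagonal_nonneg[OF M xy(2) Mpsd] .
    have Kpsd: "v \<bullet> (Kb *\<^sub>v v) \<ge> 0" if "v \<in> carrier_vec n" for v
      using Kpd[OF that] K that by (cases "v = 0\<^sub>v n") (auto simp: less_imp_le)
    obtain \<gamma> where \<gamma>: "sesq_form Kb w w = complex_of_real \<gamma>" "\<gamma> \<ge> 0"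
      using sesq_diagonal_nonneg[OF K w Kpsd] .
    have Kwy: "sesq_form Kb w y = complex_of_real \<beta>"
      using \<beta>(1) by (simp add: sesq_form_def Kw)
    have Mwy: "sesq_form M w y = complex_of_real \<gamma>"
      using \<gamma>(1) sesq_hermitian[OF M xy(2) w] by (simp add: sesq_form_def Kw)
    have Kyw: "sesq_form Kb y w = complex_of_real \<beta>"
      using Kwy sesq_hermitian[OF K w xy(2)] by simp
    have Nty: "sesq_form N t y = complex_of_real (\<alpha> + 2 * (s * \<beta>) + s\<^sup>2 * \<gamma>)"
      unfolding N_def t_def using K M w xy
      by (simp add: sesq_add_mat[of _ n] sesq_smult_mat[of _ n] sesq_add[of _ n] sesq_smult[of _ n]
          \<alpha> \<beta> Kwy Mwy power2_eq_square algebra_simps)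
    have scal: "complex_of_real \<gamma> - (z - 1) * \<eta> * \<alpha>
      = (z - 1) * z * \<eta> * complex_of_real (\<alpha> + 2 * (s * \<beta>) + s\<^sup>2 * \<gamma>)"
    proof -
      have "sesq_form M x y + (- complex_of_real \<eta>) * sesq_form Kb y y = z * (complex_of_real \<eta> * sesq_form N t y)"
      proof -
        have e: "cmat (- (\<eta> \<cdot>\<^sub>m Kb)) *\<^sub>v y = (- complex_of_real \<eta>) \<cdot>\<^sub>v (cmat Kb *\<^sub>v y)"
          using K xy by (intro eq_vecI) (auto simp: scalar_prod_def sum_distrib_left mult.assoc)
        show ?thesis
          using arg_cong[OF eq2, of "\<lambda>u. u \<bullet> conjugate y"] cM cK cN xy t
          unfolding e Sy sesq_form_def
          by (simp add: add_scalar_prod_distrib[of _ n])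
      qed
      then have "(z - 1) * sesq_form M x y - (z - 1) * \<eta> * \<alpha> = (z - 1) * (z * (complex_of_real \<eta> * sesq_form N t y))"
        by (simp add: \<alpha> algebra_simps)
      moreover have "(z - 1) * sesq_form M x y = \<gamma>"
        using Mwy sesq_smult[OF M(1) xy] by (simp add: w_def)
      ultimately show ?thesis unfolding Nty by (simp add: mult.assoc)
    qed
    define b c where "b = s * \<beta>" and "c = s\<^sup>2 * \<gamma>"
    have b: "b \<ge> 0" and c: "c \<ge> 0" using \<beta> \<gamma> s by (auto simp: b_def c_def)
    \<comment> \<open>The scaling \<open>\<eta> s\<^sup>2 = 1\<close> makes \<open>\<eta>\<close> a common factor of the equation.\<close>
    have \<gamma>c: "\<gamma> = \<eta> * c" using s(2) by (simp add: c_def mult.assoc[symmetric])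
    have quad: "complex_of_real (\<alpha> + 2 * b + c) * z\<^sup>2 + complex_of_real (- (2 * b + c)) * z
        + complex_of_real (- (\<alpha> + c)) = 0" (is "?q = 0")
    proof -
      have "complex_of_real \<gamma> - (z - 1) * \<eta> * \<alpha> = (z - 1) * z * \<eta> * complex_of_real (\<alpha> + 2 * b + c)"
        using scal by (simp only: b_def c_def)
      note this[unfolded \<gamma>c]
      then have "complex_of_real \<eta> * ?q = 0" by (simp add: power2_eq_square algebra_simps)
      then show ?thesis using \<eta> by (simp only: mult_eq_0_iff) auto
    qed
    \<comment> \<open>The left hand side is the squared \<open>Kb\<close>-norm of \<open>s w - \<surd>2 y\<close>, since \<open>y\<^sup>* Kb w = y\<^sup>* M y\<close>.\<close>
    have cs: "2 * \<alpha> - 2 * sqrt 2 * b + c \<ge> 0"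
    proof -
      define u where "u = complex_of_real s \<cdot>\<^sub>v w + complex_of_real (- sqrt 2) \<cdot>\<^sub>v y"
      have u: "u \<in> carrier_vec n" using w xy by (simp add: u_def)
      have "sesq_form Kb u u = complex_of_real (2 * \<alpha> - 2 * sqrt 2 * b + c)"
        unfolding u_def using K w xy
        by (simp add: sesq_add[of _ n] sesq_add_right[of _ n] sesq_smult[of _ n] sesq_smult_right[of _ n]
          \<alpha> \<gamma> Kwy Kyw b_def c_def power2_eq_square algebra_simps flip: of_real_mult) (simp add: algebra_simps)
      then show ?thesis using sesq_diagonal_nonneg[OF K u Kpsd] of_real_eq_iff by metis
    qed
    show ?thesis by (rule bdsc_quadratic_roots[OF \<alpha>(2) b c cs quad])
  qed
qed

section \<open>Meshes of the unit square\<close>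

lemma Omega_eq_box: "Omega = box (0, 0) (1, 1)"
  by (auto simp: Omega_def box_prod)

lemma closure_Omega: "closure Omega = cbox (0, 0) (1, 1)"
  unfolding Omega_eq_box by (rule closure_box) (auto simp: box_prod)

lemma open_Omega: "open Omega"
  by (simp add: Omega_eq_box open_box)

lemma mesh_interior_subset:
  assumes "mesh \<T>" "T \<in> \<T>"
  shows "interior T \<subseteq> Omega"
proof -
  have "interior T \<subseteq> interior (closure Omega)"
    using assms by (intro interior_mono) (auto simp: mesh_def)
  also have "\<dots> = Omega" unfolding closure_Omega by (simp add: interior_cbox Omega_eq_box)
  finally show ?thesis .
qed

lemma triangle_interior_nonempty:
  fixes T :: "(real \<times> real) set"
  assumes "2 simplex T"
  shows "interior T \<noteq> {}"
proof -
  have d: "aff_dim T = 2" using aff_dim_simplex[OF assms] .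
  then have "interior T = rel_interior T" by (simp add: interior_rel_interior_gen)
  moreover have "T \<noteq> {}" using d by auto
  ultimately show ?thesis using convex_simplex[OF assms] by (simp add: rel_interior_eq_empty)
qed

text \<open>Every point of the square lies in a triangle, hence in its interior or on its frontier, and the
  frontier of a convex set is a null set.\<close>

lemma negligible_mesh_skeleton:
  assumes "mesh \<T>"
  shows "negligible (Omega - (\<Union>T\<in>\<T>. interior T))"
proof (rule negligible_subset)
  have "convex T" if "T \<in> \<T>" for T
    using assms that convex_simplex by (auto simp: mesh_def)
  then show "negligible (\<Union>T\<in>\<T>. frontier T)"
    using assms by (auto intro!: negligible_Union negligible_convex_frontier simp: mesh_def triangulation_def)
  have "closed T" if "T \<in> \<T>" for T
    using assms that closed_simplex by (auto simp: mesh_def)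
  moreover have "Omega \<subseteq> \<Union>\<T>" using assms closure_subset by (auto simp: mesh_def)
  ultimately show "Omega - (\<Union>T\<in>\<T>. interior T) \<subseteq> (\<Union>T\<in>\<T>. frontier T)"
    by (fastforce simp: frontier_def)
qed

text \<open>The edges form a null set and there are finitely many triangles, so integrability may be checked in the
  interior of each triangle. For products of gradients, whose values on the edges are unspecified, this settles
  measurability as well.\<close>

lemma mesh_set_integrable:
  fixes f :: "real \<times> real \<Rightarrow> 'b :: euclidean_space"
  assumes mesh: "mesh \<T>" and int: "\<And>T. T \<in> \<T> \<Longrightarrow> set_integrable lebesgue (interior T) f"
  shows "set_integrable lebesgue Omega f"
proof -
  have "finite \<T>" using mesh by (simp add: mesh_def triangulation_def)
  then have "set_integrable lebesgue (\<Union>T\<in>\<T>. interior T) f"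
    by (intro set_integrable_UN int) auto
  moreover have "negligible {x \<in> (\<Union>T\<in>\<T>. interior T) - Omega. f x \<noteq> 0}"
  proof -
    have "{x \<in> (\<Union>T\<in>\<T>. interior T) - Omega. f x \<noteq> 0} = {}"
      using mesh_interior_subset[OF mesh] by blast
    then show ?thesis by (metis negligible_empty)
  qed
  moreover have "negligible {x \<in> Omega - (\<Union>T\<in>\<T>. interior T). f x \<noteq> 0}"
    using negligible_mesh_skeleton[OF mesh] by (rule negligible_subset) blast
  ultimately show ?thesis by (rule absolutely_integrable_spike_set)
qed

section \<open>Integrals of quadratic forms\<close>

lemma continuous_set_integrable_Omega:
  fixes f :: "real \<times> real \<Rightarrow> real"
  assumes "continuous_on (closure Omega) f"
  shows "set_integrable lebesgue Omega f"
proof (rule set_integrable_subset)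
  show "set_integrable lebesgue (closure Omega) f"
    using assms absolutely_integrable_continuous unfolding closure_Omega by blast
  show "Omega \<in> sets lebesgue" using open_Omega by auto
qed (rule closure_subset)

text \<open>A nonnegative function with integral zero vanishes almost everywhere, and a nonempty open set is not
  negligible. For a function that is constant on each triangle, the one zero obtained determines its value on the
  whole triangle.\<close>

lemma set_integral_eq_0_on_open:
  fixes f :: "'a :: euclidean_space \<Rightarrow> real"
  assumes int: "set_integrable lebesgue S f" and nonneg: "\<And>x. f x \<ge> 0"
    and zero: "(LINT x:S|lebesgue. f x) = 0"
    and U: "open U" "U \<noteq> {}" "U \<subseteq> S"
  obtains x where "x \<in> U" "f x = 0"
proof -
  have "AE x in lebesgue. indicator S x *\<^sub>R f x = 0"
    using int zero nonneg unfolding set_integrable_def set_lebesgue_integral_def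
    by (subst (asm) integral_nonneg_eq_0_iff_AE) auto
  then have "negligible {x. indicator S x *\<^sub>R f x \<noteq> 0}"
    unfolding eventually_ae_filter
    by (auto simp: negligible_iff_null_sets[symmetric] intro: negligible_subset)
  then have "\<not> U \<subseteq> {x. indicator S x *\<^sub>R f x \<noteq> 0}"
    using open_not_negligible[OF U(1,2)] negligible_subset by blast
  then show thesis using that U(3) by (auto simp: indicator_def)
qed

lemma set_integral_sum:
  fixes f :: "'i \<Rightarrow> 'a \<Rightarrow> 'b :: {banach, second_countable_topology}"
  assumes "\<And>i. i \<in> I \<Longrightarrow> set_integrable L S (f i)"
  shows "set_integrable L S (\<lambda>x. \<Sum>i\<in>I. f i x)"
    and "(LINT x:S|L. \<Sum>i\<in>I. f i x) = (\<Sum>i\<in>I. LINT x:S|L. f i x)"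
proof -
  have i: "integrable L (\<lambda>x. indicator S x *\<^sub>R f i x)" if "i \<in> I" for i
    using assms[OF that] by (simp add: set_integrable_def)
  show "set_integrable L S (\<lambda>x. \<Sum>i\<in>I. f i x)"
    unfolding set_integrable_def scaleR_sum_right by (intro Bochner_Integration.integrable_sum i)
  show "(LINT x:S|L. \<Sum>i\<in>I. f i x) = (\<Sum>i\<in>I. LINT x:S|L. f i x)"
    unfolding set_lebesgue_integral_def scaleR_sum_right by (intro Bochner_Integration.integral_sum i)
qed

text \<open>The mass matrix and the stiffness matrix are both Gram matrices of functions with values in an inner
  product space, the basis functions and their gradients. The quadratic form of such a matrix is the squared
  \<open>L\<^sup>2\<close> norm of the corresponding combination.\<close>

lemma gram_quadratic_form:
  fixes f :: "nat \<Rightarrow> 'a \<Rightarrow> 'b :: real_inner" and L :: "'a measure"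
  assumes int: "\<And>i j. i < n \<Longrightarrow> j < n \<Longrightarrow> set_integrable L S (\<lambda>x. inner (f i x) (f j x))"
    and v: "v \<in> carrier_vec n"
  shows "set_integrable L S (\<lambda>x. (norm (\<Sum>i<n. v $ i *\<^sub>R f i x))\<^sup>2)"
    and "v \<bullet> (mat n n (\<lambda>(i, j). LINT x:S|L. inner (f i x) (f j x)) *\<^sub>v v)
      = (LINT x:S|L. (norm (\<Sum>i<n. v $ i *\<^sub>R f i x))\<^sup>2)"
proof -
  have eq: "(norm (\<Sum>i<n. v $ i *\<^sub>R f i x))\<^sup>2
      = (\<Sum>i<n. \<Sum>j<n. v $ i * v $ j * inner (f i x) (f j x))" for x
    unfolding power2_norm_eq_inner inner_sum_left inner_sum_right
    by (auto intro!: sum.cong simp: sum_distrib_left inner_commute)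
  have i1: "set_integrable L S (\<lambda>x. v $ i * v $ j * inner (f i x) (f j x))"
    if "i < n" "j < n" for i j using int[OF that] by (intro set_integrable_mult_right)
  have i2: "set_integrable L S (\<lambda>x. \<Sum>j<n. v $ i * v $ j * inner (f i x) (f j x))"
    if "i < n" for i using that by (intro set_integral_sum i1) auto
  show "set_integrable L S (\<lambda>x. (norm (\<Sum>i<n. v $ i *\<^sub>R f i x))\<^sup>2)"
    unfolding eq by (intro set_integral_sum i2) auto
  have "(LINT x:S|L. (norm (\<Sum>i<n. v $ i *\<^sub>R f i x))\<^sup>2)
     = (\<Sum>i<n. LINT x:S|L. \<Sum>j<n. v $ i * v $ j * inner (f i x) (f j x))"
    unfolding eq by (intro set_integral_sum i2) auto
  also have "\<dots> = (\<Sum>i<n. \<Sum>j<n. LINT x:S|L. v $ i * v $ j * inner (f i x) (f j x))"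
    by (intro sum.cong refl set_integral_sum i1) auto
  also have "\<dots> = v \<bullet> (mat n n (\<lambda>(i, j). LINT x:S|L. inner (f i x) (f j x)) *\<^sub>v v)"
    using v by (simp add: scalar_prod_def sum_distrib_left lessThan_atLeast0 algebra_simps)
  finally show "v \<bullet> (mat n n (\<lambda>(i, j). LINT x:S|L. inner (f i x) (f j x)) *\<^sub>v v)
      = (LINT x:S|L. (norm (\<Sum>i<n. v $ i *\<^sub>R f i x))\<^sup>2)" by (rule sym)
qed

section \<open>Gradients of piecewise linear functions\<close>

lemma grad_affine:
  assumes "open S" "x \<in> S" and aff: "\<And>y. y \<in> S \<Longrightarrow> f y = inner g y + c"
  shows "grad f x = g"
proof -
  have "((\<lambda>y. inner g y + c) has_derivative (\<lambda>h. inner h g)) (at x)"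
    by (auto intro!: derivative_eq_intros simp: inner_commute)
  then have d: "GDERIV f x :> g"
    unfolding gderiv_def
    by (rule has_derivative_transform_within_open[OF _ assms(1,2)]) (simp add: aff)
  have "D = g" if "GDERIV f x :> D" for D
  proof -
    have "(\<lambda>h. inner h D) = (\<lambda>h. inner h g)"
      using d that unfolding gderiv_def by (rule has_derivative_unique[symmetric])
    then have "inner h D = inner h g" for h by metis
    then show ?thesis by (metis inner_commute vector_eq_rdot)
  qed
  then show ?thesis unfolding grad_def using d by blast
qed

lemma fe_space_grad:
  assumes "v \<in> fe_space \<T>" "T \<in> \<T>"
  shows "\<exists>g c. (\<forall>x\<in>T. v x = inner g x + c) \<and> (\<forall>x\<in>interior T. grad v x = g)"
proof -
  obtain g c where gc: "\<forall>x\<in>T. v x = inner g x + c"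
    using assms unfolding fe_space_def by blast
  have "grad v x = g" if "x \<in> interior T" for x
    using gc interior_subset[of T] by (intro grad_affine[OF open_interior that]) auto
  with gc show ?thesis by blast
qed

lemma fe_space_grad_integrable:
  assumes mesh: "mesh \<T>" and u: "u \<in> fe_space \<T>" and v: "v \<in> fe_space \<T>"
  shows "set_integrable lebesgue Omega (\<lambda>x. inner (grad u x) (grad v x))"
proof (rule mesh_set_integrable[OF mesh])
  fix T assume T: "T \<in> \<T>"
  obtain g where g: "\<forall>x\<in>interior T. grad u x = g" using fe_space_grad[OF u T] by blast
  obtain h where h: "\<forall>x\<in>interior T. grad v x = h" using fe_space_grad[OF v T] by blast
  have "bounded T" using mesh T compact_simplex compact_imp_bounded by (auto simp: mesh_def)
  then have "interior T \<in> lmeasurable" by (simp add: bounded_interior lmeasurable_open)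
  then have "set_integrable lebesgue (interior T) (\<lambda>x. inner g h)"
    by (simp add: absolutely_integrable_on_const)
  then show "set_integrable lebesgue (interior T) (\<lambda>x. inner (grad u x) (grad v x))"
    using set_integrable_cong[of lebesgue lebesgue "interior T" "interior T"
        "\<lambda>x. inner (grad u x) (grad v x)" "\<lambda>x. inner g h"] g h by simp
qed

text \<open>The sum rule for gradients is restricted to the interiors of triangles: on an edge the gradient of the
  combination may exist without those of the summands.\<close>

lemma fe_combination:
  fixes \<phi> :: "nat \<Rightarrow> real \<times> real \<Rightarrow> real" and c :: "nat \<Rightarrow> real"
  assumes fe: "\<And>i. i < n \<Longrightarrow> \<phi> i \<in> fe_space \<T>"
  shows "(\<lambda>x. \<Sum>i<n. c i * \<phi> i x) \<in> fe_space \<T>"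
    and "T \<in> \<T> \<Longrightarrow> x \<in> interior T \<Longrightarrow>
      grad (\<lambda>x. \<Sum>i<n. c i * \<phi> i x) x = (\<Sum>i<n. c i *\<^sub>R grad (\<phi> i) x)"
proof -
  have "\<exists>g d. (\<forall>x\<in>T. (\<Sum>i<n. c i * \<phi> i x) = inner g x + d) \<and>
      (\<forall>x\<in>interior T. g = (\<Sum>i<n. c i *\<^sub>R grad (\<phi> i) x))" if T: "T \<in> \<T>" for T
  proof -
    have "\<forall>i<n. \<exists>g d. (\<forall>x\<in>T. \<phi> i x = inner g x + d) \<and> (\<forall>x\<in>interior T. grad (\<phi> i) x = g)"
      using fe_space_grad[OF fe T] by blast
    then obtain g d where gd: "\<forall>i<n. (\<forall>x\<in>T. \<phi> i x = inner (g i) x + d i) \<and> (\<forall>x\<in>interior T. grad (\<phi> i) x = g i)"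
      by metis
    show ?thesis
      by (rule exI[of _ "\<Sum>i<n. c i *\<^sub>R g i"], rule exI[of _ "\<Sum>i<n. c i * d i"])
        (simp add: gd inner_sum_left algebra_simps sum.distrib)
  qed
  note loc = this
  have "continuous_on (closure Omega) (\<lambda>x. \<Sum>i<n. c i * \<phi> i x)"
    using fe by (intro continuous_intros) (auto simp: fe_space_def)
  then show "(\<lambda>x. \<Sum>i<n. c i * \<phi> i x) \<in> fe_space \<T>"
    using loc unfolding fe_space_def by blast
  assume T: "T \<in> \<T>" and x: "x \<in> interior T"
  then show "grad (\<lambda>x. \<Sum>i<n. c i * \<phi> i x) x = (\<Sum>i<n. c i *\<^sub>R grad (\<phi> i) x)"
  proof -
    obtain g d where gd: "\<forall>x\<in>T. (\<Sum>i<n. c i * \<phi> i x) = inner g x + d"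
      "\<forall>x\<in>interior T. g = (\<Sum>i<n. c i *\<^sub>R grad (\<phi> i) x)"
      using loc[OF T] by blast
    have "grad (\<lambda>x. \<Sum>i<n. c i * \<phi> i x) x = g"
      using gd(1) interior_subset[of T] by (intro grad_affine[OF open_interior x]) auto
    then show ?thesis using gd(2) x by simp
  qed
qed

text \<open>The gradient is constant in each triangle, so one zero makes it vanish there. A piecewise linear function
  whose gradient vanishes on every triangle takes only finitely many
  values, one per triangle; being continuous on a connected set, it is constant.\<close>

lemma fe_space_grad_zero_imp_constant:
  assumes mesh: "mesh \<T>" and u: "u \<in> fe_space \<T>"
    and zero: "\<And>T. T \<in> \<T> \<Longrightarrow> \<exists>x\<in>interior T. grad u x = 0"
  obtains k where "\<And>x. x \<in> closure Omega \<Longrightarrow> u x = k"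
proof -
  have "\<exists>k. \<forall>x\<in>T. u x = k" if T: "T \<in> \<T>" for T
  proof -
    obtain g c where gc: "\<forall>x\<in>T. u x = inner g x + c" "\<forall>x\<in>interior T. grad u x = g"
      using fe_space_grad[OF u T] by blast
    with zero[OF T] have "g = 0" by auto
    with gc(1) show ?thesis by auto
  qed
  then obtain k where k: "\<And>T x. T \<in> \<T> \<Longrightarrow> x \<in> T \<Longrightarrow> u x = k T" by metis
  have "u ` closure Omega \<subseteq> k ` \<T>" using mesh k by (fastforce simp: mesh_def)
  moreover have "finite \<T>" using mesh by (simp add: mesh_def triangulation_def)
  ultimately have "finite (u ` closure Omega)" by (meson finite_imageI finite_subset)
  moreover have "connected (closure Omega)"
    unfolding closure_Omega by (intro convex_connected convex_box)
  moreover have "continuous_on (closure Omega) u" using u by (simp add: fe_space_def)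
  ultimately have "u constant_on closure Omega" using continuous_finite_range_constant by blast
  then show thesis using that by (auto simp: constant_on_def)
qed

section \<open>Definiteness of the finite element matrices\<close>

lemma nodal_basis_facts:
  assumes mesh: "mesh \<T>" and node: "bij_betw node {..<n} (mesh_nodes \<T>)" and nb: "nodal_basis \<T> \<phi>"
  shows "\<And>i. i < n \<Longrightarrow> \<phi> (node i) \<in> fe_space \<T>"
    and "\<And>i j. i < n \<Longrightarrow> j < n \<Longrightarrow> \<phi> (node i) (node j) = (if i = j then 1 else 0)"
    and "\<And>i. i < n \<Longrightarrow> node i \<in> closure Omega"
proof -
  have nodes: "node i \<in> mesh_nodes \<T>" if "i < n" for i
    using node that by (auto simp: bij_betw_def)
  show "\<phi> (node i) \<in> fe_space \<T>" if "i < n" for i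
    using nb nodes[OF that] by (auto simp: nodal_basis_def)
  have node_inj: "node i = node j \<longleftrightarrow> i = j" if "i < n" "j < n" for i j
    using node that by (auto simp: bij_betw_def inj_on_def)
  show "\<phi> (node i) (node j) = (if i = j then 1 else 0)" if "i < n" "j < n" for i j
    using nb nodes that node_inj[OF that] by (auto simp: nodal_basis_def)
  show "node i \<in> closure Omega" if "i < n" for i
    using nodes[OF that] mesh by (auto simp: mesh_nodes_def mesh_def extreme_point_of_def)
qed

lemma mass_matrix_symmetric:
  shows "mass_matrix n node \<phi> \<in> carrier_mat n n"
    and "transpose_mat (mass_matrix n node \<phi>) = mass_matrix n node \<phi>"
proof -
  show "mass_matrix n node \<phi> \<in> carrier_mat n n" by (simp add: mass_matrix_def)
  show "transpose_mat (mass_matrix n node \<phi>) = mass_matrix n node \<phi>"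
    by (intro eq_matI) (auto simp: mass_matrix_def mult.commute)
qed

lemma mass_matrix_nonneg:
  assumes cont: "\<And>i. i < n \<Longrightarrow> continuous_on (closure Omega) (\<phi> (node i))"
    and v: "v \<in> carrier_vec n"
  shows "v \<bullet> (mass_matrix n node \<phi> *\<^sub>v v) \<ge> 0"
proof -
  have "set_integrable lebesgue Omega (\<lambda>x. inner (\<phi> (node i) x) (\<phi> (node j) x))" if "i < n" "j < n" for i j
    using that by (intro continuous_set_integrable_Omega continuous_on_inner cont)
  from gram_quadratic_form(2)[OF this v]
  have "v \<bullet> (mass_matrix n node \<phi> *\<^sub>v v) = (LINT x:Omega|lebesgue. (norm (\<Sum>i<n. v $ i *\<^sub>R \<phi> (node i) x))\<^sup>2)"
    by (simp add: mass_matrix_def)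
  also have "\<dots> \<ge> 0" unfolding set_lebesgue_integral_def by (intro Bochner_Integration.integral_nonneg) auto
  finally show ?thesis .
qed

lemma Kbar_matrix_symmetric:
  assumes Kb: "Kb = Kbar_matrix (stiffness_matrix n node \<phi>) (mean_vector n node \<phi>)"
  shows "Kb \<in> carrier_mat n n"
    and "i < n \<Longrightarrow> j < n \<Longrightarrow>
      Kb $$ (i, j) = stiffness_matrix n node \<phi> $$ (i, j) + mean_vector n node \<phi> $ i * mean_vector n node \<phi> $ j"
    and "transpose_mat Kb = Kb"
proof -
  have Kc: "stiffness_matrix n node \<phi> \<in> carrier_mat n n" by (simp add: stiffness_matrix_def)
  have mc: "mean_vector n node \<phi> \<in> carrier_vec n" by (simp add: mean_vector_def)
  show Kbc: "Kb \<in> carrier_mat n n"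
    using Kc mc by (intro carrier_matI) (simp_all add: Kb Kbar_matrix_def)
  have entry: "Kb $$ (i, j) = stiffness_matrix n node \<phi> $$ (i, j) + mean_vector n node \<phi> $ i * mean_vector n node \<phi> $ j"
    if "i < n" "j < n" for i j
    using that Kc mc
    by (simp add: Kb Kbar_matrix_def scalar_prod_def mat_of_cols_index mat_of_rows_index)
  then show "i < n \<Longrightarrow> j < n \<Longrightarrow>
      Kb $$ (i, j) = stiffness_matrix n node \<phi> $$ (i, j) + mean_vector n node \<phi> $ i * mean_vector n node \<phi> $ j" .
  show "transpose_mat Kb = Kb"
  proof (rule eq_matI)
    fix i j assume "i < dim_row Kb" "j < dim_col Kb"
    then have ij: "i < n" "j < n" using Kbc by auto
    then show "transpose_mat Kb $$ (i, j) = Kb $$ (i, j)"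
      using Kbc by (simp add: entry) (simp add: stiffness_matrix_def inner_commute mult.commute)
  qed (use Kbc in auto)
qed

text \<open>The quadratic form of \<open>Kb\<close> at the coefficient vector of a finite element function \<open>u\<close> is
  \<open>\<integral>\<bar>\<nabla>u\<bar>\<^sup>2 + (\<integral>u)\<^sup>2\<close>. If it vanishes, then \<open>u\<close> is constant, the constant is zero because the mean is, and
  the coefficients are the nodal values of \<open>u\<close>. The rank-one term is what removes the constants from the kernel of
  the stiffness matrix.\<close>

lemma Kbar_matrix_positive_definite:
  assumes mesh: "mesh \<T>" and node: "bij_betw node {..<n} (mesh_nodes \<T>)" and nb: "nodal_basis \<T> \<phi>"
    and Kb: "Kb = Kbar_matrix (stiffness_matrix n node \<phi>) (mean_vector n node \<phi>)"
    and v: "v \<in> carrier_vec n" "v \<noteq> 0\<^sub>v n"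
  shows "v \<bullet> (Kb *\<^sub>v v) > 0"
proof -
  define K where "K = stiffness_matrix n node \<phi>"
  define m where "m = mean_vector n node \<phi>"
  note fe = nodal_basis_facts(1)[OF mesh node nb]
    and nodal = nodal_basis_facts(2)[OF mesh node nb]
    and node_in = nodal_basis_facts(3)[OF mesh node nb]
  have cont: "continuous_on (closure Omega) (\<phi> (node i))" if "i < n" for i
    using fe[OF that] by (simp add: fe_space_def)
  have Kc: "K \<in> carrier_mat n n" by (simp add: K_def stiffness_matrix_def)
  have mc: "m \<in> carrier_vec n" by (simp add: m_def mean_vector_def)
  note Kbc = Kbar_matrix_symmetric(1)[OF Kb]
    and Kb_entry = Kbar_matrix_symmetric(2)[OF Kb, folded K_def m_def]
  define u where "u x = (\<Sum>i<n. v $ i * \<phi> (node i) x)" for x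
  \<comment> \<open>This is \<open>\<bar>\<nabla>u\<bar>\<^sup>2\<close> in the interior of each triangle, but possibly not on the edges.\<close>
  define G where "G x = (norm (\<Sum>i<n. v $ i *\<^sub>R grad (\<phi> (node i)) x))\<^sup>2" for x
  have gi: "set_integrable lebesgue Omega (\<lambda>x. inner (grad (\<phi> (node i)) x) (grad (\<phi> (node j)) x))"
    if "i < n" "j < n" for i j
    using fe_space_grad_integrable[OF mesh] fe that by blast
  have Gint: "set_integrable lebesgue Omega G"
    and KG: "v \<bullet> (K *\<^sub>v v) = (LINT x:Omega|lebesgue. G x)"
    using gram_quadratic_form[OF gi v(1)] by (simp_all add: K_def stiffness_matrix_def G_def[abs_def])
  have Gnn: "(LINT x:Omega|lebesgue. G x) \<ge> 0"
    unfolding set_lebesgue_integral_def G_def by (intro Bochner_Integration.integral_nonneg) auto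
  have mu: "m \<bullet> v = (LINT x:Omega|lebesgue. u x)"
  proof -
    have "(LINT x:Omega|lebesgue. u x) = (\<Sum>i<n. LINT x:Omega|lebesgue. v $ i * \<phi> (node i) x)"
      unfolding u_def
      by (intro set_integral_sum(2) set_integrable_mult_right continuous_set_integrable_Omega cont) auto
    then show ?thesis using v(1)
      by (simp add: m_def mean_vector_def scalar_prod_def lessThan_atLeast0 mult.commute)
  qed
  have split: "v \<bullet> (Kb *\<^sub>v v) = (LINT x:Omega|lebesgue. G x) + (LINT x:Omega|lebesgue. u x)\<^sup>2"
  proof -
    have "v \<bullet> (Kb *\<^sub>v v) = v \<bullet> (K *\<^sub>v v) + (m \<bullet> v)\<^sup>2"
      using Kbc Kc mc v(1)
      by (simp add: scalar_prod_def Kb_entry power2_eq_square sum_product algebra_simps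
          sum.distrib sum_distrib_left)
    then show ?thesis by (simp add: KG mu)
  qed
  have "v \<bullet> (Kb *\<^sub>v v) \<noteq> 0"
  proof
    assume "v \<bullet> (Kb *\<^sub>v v) = 0"
    then have G0: "(LINT x:Omega|lebesgue. G x) = 0" and u0: "(LINT x:Omega|lebesgue. u x) = 0"
      using split Gnn by (smt (verit) zero_le_power2 power2_eq_square mult_eq_0_iff)+
    have ufe: "u \<in> fe_space \<T>"
      unfolding u_def[abs_def] by (intro fe_combination fe)
    have "\<exists>x\<in>interior T. grad u x = 0" if T: "T \<in> \<T>" for T
    proof -
      have "interior T \<noteq> {}" using mesh T triangle_interior_nonempty by (auto simp: mesh_def)
      then obtain x where x: "x \<in> interior T" "G x = 0"
        using set_integral_eq_0_on_open[OF Gint _ G0 open_interior _ mesh_interior_subset[OF mesh T]]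
        by (metis G_def zero_le_power2)
      have "grad u x = (\<Sum>i<n. v $ i *\<^sub>R grad (\<phi> (node i)) x)"
        unfolding u_def[abs_def] by (rule fe_combination(2)[OF fe T x(1)])
      then show ?thesis using x by (auto simp: G_def)
    qed
    then obtain k where k: "\<And>x. x \<in> closure Omega \<Longrightarrow> u x = k"
      using fe_space_grad_zero_imp_constant[OF mesh ufe] by metis
    have "(LINT x:Omega|lebesgue. u x) = (LINT x:Omega|lebesgue. k)"
      using open_Omega k closure_subset[of Omega] by (intro set_lebesgue_integral_cong) auto
    also have "\<dots> = k * measure lebesgue Omega"
      by (simp add: set_lebesgue_integral_def)
    finally have "k * measure lebesgue Omega = 0" using u0 by simp
    moreover have "measure lebesgue Omega \<noteq> 0"
    proof
      assume "measure lebesgue Omega = 0"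
      moreover have "Omega \<in> lmeasurable"
        using open_Omega by (simp add: lmeasurable_open Omega_eq_box)
      ultimately have "negligible Omega" by (simp add: negligible_iff_measure)
      moreover have "(1/2, 1/2) \<in> Omega" by (simp add: Omega_def)
      ultimately show False using open_not_negligible[OF open_Omega] by blast
    qed
    ultimately have "k = 0" by simp
    have "v $ j = 0" if "j < n" for j
    proof -
      have "u (node j) = v $ j"
        using that by (simp add: u_def nodal if_distrib[of "\<lambda>t. _ * t"] cong: if_cong)
      then show ?thesis using k[OF node_in[OF that]] \<open>k = 0\<close> by simp
    qed
    then show False using v by (metis eq_vecI carrier_vecD index_zero_vec)
  qed
  moreover have "v \<bullet> (Kb *\<^sub>v v) \<ge> 0" using split Gnn by simp
  ultimately show ?thesis by simp
qed

section \<open>The spectral bounds\<close>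

theorem theorem5p4:
  fixes \<T> :: "(real \<times> real) set set"
    and n :: nat
    and node :: "nat \<Rightarrow> real \<times> real"
    and \<phi> :: "real \<times> real \<Rightarrow> real \<times> real \<Rightarrow> real"
    and \<eta> :: real
    and M K Kb :: "real mat"
    and m :: "real vec"
    and z :: complex
  assumes "mesh \<T>"
    and "bij_betw node {..<n} (mesh_nodes \<T>)"
    and "nodal_basis \<T> \<phi>"
    and "\<eta> > 0"
    and "M = mass_matrix n node \<phi>"
    and "K = stiffness_matrix n node \<phi>"
    and "m = mean_vector n node \<phi>"
    and "Kb = Kbar_matrix K m"
    and "eigenvalue (map_mat complex_of_real (minv (B_bdsc \<eta> Kb M) * system_matrix \<eta> Kb M)) z"
  shows "z \<in> complex_of_real ` ({-1 .. 1 - sqrt 2} \<union> {1 .. (sqrt 5 + 1) / 2})"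
proof -
  have Kb: "Kb = Kbar_matrix (stiffness_matrix n node \<phi>) (mean_vector n node \<phi>)"
    using assms(6-8) by simp
  have "continuous_on (closure Omega) (\<phi> (node i))" if "i < n" for i
    using nodal_basis_facts(1)[OF assms(1-3) that] by (simp add: fe_space_def)
  then have nonneg: "v \<bullet> (M *\<^sub>v v) \<ge> 0" if "v \<in> carrier_vec n" for v
    unfolding assms(5) using that by (rule mass_matrix_nonneg)
  note mass = mass_matrix_symmetric[of n node \<phi>, folded assms(5)] nonneg
  show ?thesis
    by (rule bdsc_eigenvalue_bounds[OF Kbar_matrix_symmetric(1,3)[OF Kb]
          Kbar_matrix_positive_definite[OF assms(1-3) Kb] mass assms(4,9)])
qed

end
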